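(* If there exists a nondiscrete extremally disconnected Hausdorff topological group of Ulam nonmeasurable cardinality with linear topology, then there exists a nondiscrete extremally disconnected Boolean (Hausdorff) topological group with linear topology admitting a continuous isomorphism onto a subgroup of $\mathbb{Z}_2^\omega$ with the product topology.
   Context: A topological space is extremally disconnected if the closure of any open set in it is open; a topological group is extremally disconnected if its underlying space is. A topological group has linear topology if its open subgroups form a base of neighborhoods of the identity element. A Boolean group is a group in which all nonidentity elements have order $2$. A cardinal $\kappa$ is Ulam measurable if there is a nonprincipal ultrafilter on $\kappa$ which is $\sigma$-complete (i.e., closed under countable intersections); otherwise it is Ulam nonmeasurable. $\mathbb{Z}_2$ is the two-element group with the discrete topology, and $\mathbb{Z}_2^\omega$ is its countably infinite Cartesian power. A continuous isomorphism is a group isomorphism that is continuous (its inverse is not required to be continuous); the subgroup of $\mathbb{Z}_2^\omega$ carries the subspace topology. *)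

theory Defs
  imports
    "HOL-Analysis.Analysis"
    "HOL-Algebra.Multiplicative_Group"
    "HOL-Algebra.Product_Groups"
begin

definition extremally_disconnected_space :: "'a topology \<Rightarrow> bool" where
  "extremally_disconnected_space T \<longleftrightarrow>
     (\<forall>U. openin T U \<longrightarrow> openin T (Abstract_Topology.closure_of T U))"

definition topological_group :: "'a monoid \<Rightarrow> 'a topology \<Rightarrow> bool" where
  "topological_group G T \<longleftrightarrow>
     group G \<and> topspace T = carrier G \<and>
     continuous_map (prod_topology T T) T (\<lambda>(x, y). x \<otimes>\<^bsub>G\<^esub> y) \<and>
     continuous_map T T (\<lambda>x. inv\<^bsub>G\<^esub> x)"

definition linear_group_topology :: "'a monoid \<Rightarrow> 'a topology \<Rightarrow> bool" where
  "linear_group_topology G T \<longleftrightarrow>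
     (\<forall>U. openin T U \<and> \<one>\<^bsub>G\<^esub> \<in> U \<longrightarrow> (\<exists>H. subgroup H G \<and> openin T H \<and> H \<subseteq> U))"

definition boolean_group :: "'a monoid \<Rightarrow> bool" where
  "boolean_group G \<longleftrightarrow> group G \<and> (\<forall>x \<in> carrier G. x \<noteq> \<one>\<^bsub>G\<^esub> \<longrightarrow> group.ord G x = 2)"

definition ultrafilter_on :: "'a set \<Rightarrow> 'a set set \<Rightarrow> bool" where
  "ultrafilter_on X F \<longleftrightarrow>
     F \<subseteq> Pow X \<and> X \<in> F \<and> {} \<notin> F \<and>
     (\<forall>A \<in> F. \<forall>B \<in> F. A \<inter> B \<in> F) \<and>
     (\<forall>A \<in> F. \<forall>B. A \<subseteq> B \<and> B \<subseteq> X \<longrightarrow> B \<in> F) \<and>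
     (\<forall>A. A \<subseteq> X \<longrightarrow> A \<in> F \<or> X - A \<in> F)"

definition principal_on :: "'a set \<Rightarrow> 'a set set \<Rightarrow> bool" where
  "principal_on X F \<longleftrightarrow> (\<exists>x \<in> X. F = {A. A \<subseteq> X \<and> x \<in> A})"

definition sigma_complete :: "'a set set \<Rightarrow> bool" where
  "sigma_complete F \<longleftrightarrow> (\<forall>\<A>. \<A> \<subseteq> F \<and> \<A> \<noteq> {} \<and> countable \<A> \<longrightarrow> \<Inter>\<A> \<in> F)"

text \<open>Cardinals are represented, as in HOL's cardinal library, by well-order relations;
  the underlying set of \<open>\<kappa>\<close> is its field, and \<open>card_of A\<close> is the cardinality of \<open>A\<close>.\<close>

definition Ulam_measurable :: "'a rel \<Rightarrow> bool" where
  "Ulam_measurable \<kappa> \<longleftrightarrow>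
     (\<exists>F. ultrafilter_on (Field \<kappa>) F \<and> \<not> principal_on (Field \<kappa>) F \<and> sigma_complete F)"

definition Z2_omega :: "(nat \<Rightarrow> int) monoid" where
  "Z2_omega = product_group UNIV (\<lambda>_. integer_mod_group 2)"

definition Z2_omega_topology :: "(nat \<Rightarrow> int) topology" where
  "Z2_omega_topology =
     product_topology (\<lambda>_. discrete_topology (carrier (integer_mod_group 2))) UNIV"

definition continuous_isomorphism ::
  "'a monoid \<Rightarrow> 'a topology \<Rightarrow> 'b monoid \<Rightarrow> 'b topology \<Rightarrow> ('a \<Rightarrow> 'b) \<Rightarrow> bool" where
  "continuous_isomorphism G T H S h \<longleftrightarrow> h \<in> iso G H \<and> continuous_map T S h"

text \<open>HOL cannot quantify existentially over types, so an existence claim about groups has to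
  fix a type for the carrier. For groups that embed in \<open>Z2_omega\<close> as abstract groups, the type
  \<open>nat \<Rightarrow> int\<close> loses no generality: group structure and topology can be transported along an
  injection. A group of arbitrary size is rendered by a free type variable.\<close>

end

(*
  Inversion is a homeomorphism, so in an extremally disconnected group its fixed points form a
  neighbourhood of the identity; hence some open subgroup E is Boolean. If all countable
  intersections of open subgroups were open, a maximal disjoint family of open sets whose closures
  miss the identity would carry a sigma-complete nonprincipal ultrafilter. So E has a decreasing
  sequence of open subgroups H_n, with H_0 = E, whose intersection N is not open.

  Fix coordinates of E modulo H_(n+1) as a vector space over the two-element field, and colour x in
  H_n - H_(n+1) by the parity of the 2-adic valuation of the number of its nonzero coordinates.
  Both colour classes are open, so the identity is not in the closure of one of them, and some open
  subgroup L has L - N monochromatic. For some p, a sum of two vectors from a sunflower has 2p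
  nonzero coordinates and a sum of four has 4p, and these differ in colour; hence L meets H_n in a subgroup that
  is countable modulo H_(n+1) and so involves only countably many coordinates. Over all n these
  coordinates are countably many continuous characters of E whose common kernel is not open. The
  group required is the image of E under them in Z_2^omega, with the quotient topology.
*)
theory Submission
  imports Defs
begin

no_notation eq_closure_of ("closure'_of\<index>")

section \<open>Linear group topologies\<close>

locale linear_topological_group = group G for G :: "'a monoid" (structure) +
  fixes T :: "'a topology"
  assumes topological_group: "topological_group G T"
    and linear: "linear_group_topology G T"
begin

definition open_subgroup :: "'a set \<Rightarrow> bool" where
  "open_subgroup H \<longleftrightarrow> subgroup H G \<and> openin T H"

lemma topspace_eq: "topspace T = carrier G"
  using topological_group by (simp add: topological_group_def)

lemma continuous_map_translation:
  assumes "x \<in> carrier G"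
  shows "continuous_map T T (\<lambda>y. x \<otimes> y)"
proof -
  have "continuous_map T (prod_topology T T) (\<lambda>y. (x, y))"
    using assms by (intro continuous_map_pairedI) (auto simp: topspace_eq)
  moreover have "continuous_map (prod_topology T T) T (\<lambda>(x, y). x \<otimes> y)"
    using topological_group by (simp add: topological_group_def)
  ultimately show ?thesis
    using continuous_map_compose by (fastforce simp: o_def)
qed

lemma obtain_open_subgroup:
  assumes "openin T U" "\<one> \<in> U"
  obtains H where "open_subgroup H" "H \<subseteq> U"
  using assms linear unfolding linear_group_topology_def open_subgroup_def by blast

text \<open>Continuity of translations turns a neighbourhood of \<open>x\<close> into a coset of an
  open subgroup, so the open subgroups determine the topology. Openness of a set is mostly verified
  below through this criterion.\<close>

lemma openin_iff:
  "openin T U \<longleftrightarrow>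
     U \<subseteq> carrier G \<and> (\<forall>x\<in>U. \<exists>H. open_subgroup H \<and> (\<forall>h\<in>H. x \<otimes> h \<in> U))"
proof
  assume U: "openin T U"
  then have sub: "U \<subseteq> carrier G"
    using openin_subset topspace_eq by blast
  moreover have "\<exists>H. open_subgroup H \<and> (\<forall>h\<in>H. x \<otimes> h \<in> U)" if "x \<in> U" for x
  proof -
    have x: "x \<in> carrier G"
      using that sub by auto
    have "openin T {y \<in> topspace T. x \<otimes> y \<in> U}"
      using U continuous_map_translation[OF x] openin_continuous_map_preimage by blast
    moreover have "\<one> \<in> {y \<in> topspace T. x \<otimes> y \<in> U}"
      using that x by (simp add: topspace_eq)
    ultimately show ?thesis
      by (elim obtain_open_subgroup) auto
  qed
  ultimately show "U \<subseteq> carrier G \<and> (\<forall>x\<in>U. \<exists>H. open_subgroup H \<and> (\<forall>h\<in>H. x \<otimes> h \<in> U))"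
    by blast
next
  assume R: "U \<subseteq> carrier G \<and> (\<forall>x\<in>U. \<exists>H. open_subgroup H \<and> (\<forall>h\<in>H. x \<otimes> h \<in> U))"
  show "openin T U"
  proof (subst openin_subopen, rule ballI)
    fix x assume "x \<in> U"
    then obtain H where H: "open_subgroup H" "\<forall>h\<in>H. x \<otimes> h \<in> U" and x: "x \<in> carrier G"
      using R by blast
    \<comment> \<open>This is the coset of \<open>H\<close> at \<open>x\<close>, written as a
      preimage of \<open>H\<close> under translation by \<open>inv x\<close> so that its openness is
      immediate.\<close>
    let ?V = "{y \<in> topspace T. inv x \<otimes> y \<in> H}"
    have "openin T ?V"
      using H continuous_map_translation[of "inv x"] x openin_continuous_map_preimage
      unfolding open_subgroup_def by blast
    moreover have "x \<in> ?V"
      using x H subgroup.one_closed by (force simp: topspace_eq open_subgroup_def)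
    moreover have "?V \<subseteq> U"
    proof
      fix y assume "y \<in> ?V"
      then have "x \<otimes> (inv x \<otimes> y) \<in> U" "y \<in> carrier G"
        using H by (auto simp: topspace_eq)
      then show "y \<in> U"
        using x by (simp add: m_assoc[symmetric])
    qed
    ultimately show "\<exists>V. openin T V \<and> x \<in> V \<and> V \<subseteq> U"
      by blast
  qed
qed

lemma open_subgroup_Int:
  "open_subgroup H \<Longrightarrow> open_subgroup L \<Longrightarrow> open_subgroup (H \<inter> L)"
  by (auto simp: open_subgroup_def subgroups_Inter_pair)

lemma open_subgroup_carrier: "open_subgroup (carrier G)"
  using openin_topspace[of T] by (simp add: open_subgroup_def topspace_eq subgroup_self)

lemma one_in_open_subgroup: "open_subgroup H \<Longrightarrow> \<one> \<in> H"
  by (simp add: open_subgroup_def subgroup.one_closed)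

lemma open_subgroup_superset:
  assumes "open_subgroup H" "H \<subseteq> L" "subgroup L G"
  shows "open_subgroup L"
proof -
  have "openin T L"
    unfolding openin_iff
    using assms subgroup.m_closed[OF assms(3)] subgroup.subset[OF assms(3)] by blast
  then show ?thesis
    using assms(3) by (simp add: open_subgroup_def)
qed

text \<open>The form in which extremal disconnectedness yields subgroups: separating a set from the
  identity costs only passing to an open subgroup.\<close>

lemma not_in_closure_iff:
  assumes "W \<subseteq> carrier G"
  shows "\<one> \<notin> T closure_of W \<longleftrightarrow> (\<exists>H. open_subgroup H \<and> H \<inter> W = {})"
proof
  assume "\<one> \<notin> T closure_of W"
  then obtain U where "\<one> \<in> U" "openin T U" "U \<inter> W = {}"
    by (auto simp: in_closure_of topspace_eq)
  then show "\<exists>H. open_subgroup H \<and> H \<inter> W = {}"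
    by (metis obtain_open_subgroup disjoint_iff subsetD)
next
  assume "\<exists>H. open_subgroup H \<and> H \<inter> W = {}"
  then obtain H where "open_subgroup H" "H \<inter> W = {}"
    by blast
  then show "\<one> \<notin> T closure_of W"
    using one_in_open_subgroup by (auto simp: in_closure_of open_subgroup_def)
qed

end

text \<open>By commutativity the product of a coset of \<open>L\<close> at \<open>x\<close> and one
  at \<open>y\<close> lies in the coset at \<open>x \<otimes> y\<close>, and inversion acts
  likewise; this gives continuity. The members of \<L> are themselves open, hence linearity. It
  serves both for an open subgroup and for the image in \<open>Z2_omega\<close>.\<close>

lemma linear_topological_groupI:
  fixes G (structure)
  assumes "comm_group G"
    and sub: "\<And>L. L \<in> \<L> \<Longrightarrow> subgroup L G"
    and openin_iff: "\<And>U. openin T U \<longleftrightarrow>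
       U \<subseteq> carrier G \<and> (\<forall>x\<in>U. \<exists>L\<in>\<L>. \<forall>l\<in>L. x \<otimes> l \<in> U)"
    and "\<L> \<noteq> {}"
  shows "linear_topological_group G T"
proof -
  interpret comm_group G by fact
  obtain L0 where L0: "L0 \<in> \<L>"
    using assms by blast
  have "openin T (carrier G)"
    unfolding openin_iff[of "carrier G"]
    using L0 subgroup.mem_carrier[OF sub[OF L0]] by blast
  then have top: "topspace T = carrier G"
    using openin_iff[of "topspace T"] openin_topspace[of T] openin_subset by (meson subset_antisym)
  have sc: "l \<in> carrier G" if "l \<in> L" "L \<in> \<L>" for l L
    using subgroup.mem_carrier[OF sub[OF that(2)] that(1)] .
  have coset: "openin T {x \<otimes> l | l. l \<in> L}" if x: "x \<in> carrier G" and L: "L \<in> \<L>" for x L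
  proof -
    have "x \<otimes> l \<otimes> k \<in> {x \<otimes> l | l. l \<in> L}" if "l \<in> L" "k \<in> L" for l k
      using x that m_assoc[of x l k] sc[OF _ L] subgroup.m_closed[OF sub[OF L]] by auto
    then show ?thesis
      unfolding openin_iff using x L sc by blast
  qed
  have mem: "x \<in> {x \<otimes> l | l. l \<in> L}" if "x \<in> carrier G" "L \<in> \<L>" for x L
    using subgroup.one_closed[OF sub[OF that(2)]] r_one[OF that(1)] by force
  have nbhd: "\<exists>L\<in>\<L>. \<forall>l\<in>L. x \<otimes> l \<in> U" if "openin T U" "x \<in> U" for x U
    using that openin_iff by blast
  have "continuous_map (prod_topology T T) T (\<lambda>(x, y). x \<otimes> y)"
    unfolding continuous_map_def
  proof (intro conjI allI impI)
    show "(\<lambda>(x, y). x \<otimes> y) \<in> topspace (prod_topology T T) \<rightarrow> topspace T"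
      by (auto simp: top)
    fix U assume U: "openin T U"
    show "openin (prod_topology T T)
            {p \<in> topspace (prod_topology T T). (case p of (x, y) \<Rightarrow> x \<otimes> y) \<in> U}"
      (is "openin _ ?P")
      unfolding openin_prod_topology_alt
    proof (intro allI impI)
      fix x y assume "(x, y) \<in> ?P"
      then have x: "x \<in> carrier G" and y: "y \<in> carrier G" and xy: "x \<otimes> y \<in> U"
        by (auto simp: top)
      obtain L where L: "L \<in> \<L>" "\<forall>l\<in>L. x \<otimes> y \<otimes> l \<in> U"
        using nbhd U xy by blast
      let ?A = "{x \<otimes> l | l. l \<in> L}" and ?B = "{y \<otimes> l | l. l \<in> L}"
      have "x \<otimes> l \<otimes> (y \<otimes> k) \<in> U" if "l \<in> L" "k \<in> L" for l k
      proof -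
        have "x \<otimes> l \<otimes> (y \<otimes> k) = x \<otimes> y \<otimes> (l \<otimes> k)"
          using x y sc[OF that(1) L(1)] sc[OF that(2) L(1)] by (simp add: m_ac)
        then show ?thesis
          using L(2) subgroup.m_closed[OF sub[OF L(1)] that] by simp
      qed
      then have "?A \<times> ?B \<subseteq> ?P"
        using x y sc[OF _ L(1)] by (auto simp: top)
      then show "\<exists>A B. openin T A \<and> openin T B \<and> x \<in> A \<and> y \<in> B \<and> A \<times> B \<subseteq> ?P"
        using coset[OF x L(1)] coset[OF y L(1)] mem[OF x L(1)] mem[OF y L(1)]
        by (intro exI[of _ ?A] exI[of _ ?B]) simp
    qed
  qed
  moreover have "continuous_map T T (\<lambda>x. inv x)"
    unfolding continuous_map_def
  proof (intro conjI allI impI)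
    show "(\<lambda>x. inv x) \<in> topspace T \<rightarrow> topspace T"
      unfolding top by (rule funcsetI) (rule inv_closed)
    fix U assume U: "openin T U"
    define P where "P = {x \<in> topspace T. inv x \<in> U}"
    have P_iff: "x \<in> P \<longleftrightarrow> x \<in> carrier G \<and> inv x \<in> U" for x
      by (simp add: P_def top)
    have "\<exists>L\<in>\<L>. \<forall>l\<in>L. x \<otimes> l \<in> P" if "x \<in> P" for x
    proof -
      have x: "x \<in> carrier G" "inv x \<in> U"
        using that by (simp_all add: P_iff)
      obtain L where L: "L \<in> \<L>" "\<forall>l\<in>L. inv x \<otimes> l \<in> U"
        using nbhd U x by blast
      have "x \<otimes> l \<in> P" if l: "l \<in> L" for l
      proof -
        have "inv x \<otimes> inv l \<in> U"
          using L(2) subgroup.m_inv_closed[OF sub[OF L(1)] l] by simp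
        then show ?thesis
          using x sc[OF l L(1)] by (simp add: P_iff inv_mult)
      qed
      then show ?thesis
        using L by auto
    qed
    then have "openin T P"
      unfolding openin_iff[of P] by (auto simp: P_iff)
    then show "openin T {x \<in> topspace T. inv x \<in> U}"
      by (simp add: P_def)
  qed
  moreover have "linear_group_topology G T"
    unfolding linear_group_topology_def
  proof (intro allI impI, elim conjE)
    fix U assume "openin T U" "\<one> \<in> U"
    then obtain L where L: "L \<in> \<L>" "\<forall>l\<in>L. \<one> \<otimes> l \<in> U"
      using nbhd by blast
    then have "L \<subseteq> U"
      using sc by fastforce
    moreover have "openin T L"
      unfolding openin_iff[of L]
      using L(1) subgroup.m_closed[OF sub[OF L(1)]] subgroup.subset[OF sub[OF L(1)]] by blast
    ultimately show "\<exists>H. subgroup H G \<and> openin T H \<and> H \<subseteq> U"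
      using L sub by blast
  qed
  ultimately show ?thesis
    by unfold_locales (auto simp: topological_group_def top is_group)
qed

text \<open>The closure of \<open>A\<close> misses the open set \<open>B\<close>; being open itself,
  that closure then misses the closure of \<open>B\<close> too.\<close>

lemma extremally_disconnected_disjoint_closures:
  assumes "extremally_disconnected_space T" "openin T A" "openin T B" "A \<inter> B = {}"
  shows "T closure_of A \<inter> T closure_of B = {}"
proof -
  have "T closure_of A \<inter> B = {}"
    using assms by (simp add: openin_Int_closure_of_eq_empty inf_commute)
  moreover have "openin T (T closure_of A)"
    using assms by (simp add: extremally_disconnected_space_def)
  ultimately show ?thesis
    by (simp add: openin_Int_closure_of_eq_empty)
qed

section \<open>Fixed points of inversion and Isbell's theorem\<close>

text \<open>Take a maximal open \<open>M\<close> disjoint from its image \<open>N\<close>. Their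
  closures are disjoint and exchanged by \<sigma>, so a fixed point lies in neither; off these
  closures, maximality leaves only fixed points.\<close>

lemma involution_fixed_points_nhd:
  assumes "Hausdorff_space T" "extremally_disconnected_space T"
    and cont: "continuous_map T T \<sigma>"
    and invol: "\<And>x. x \<in> topspace T \<Longrightarrow> \<sigma> (\<sigma> x) = x"
    and p: "p \<in> topspace T" "\<sigma> p = p"
  obtains V where "openin T V" "p \<in> V" "\<And>x. x \<in> V \<Longrightarrow> \<sigma> x = x"
proof -
  have \<sigma>_top: "\<sigma> x \<in> topspace T" if "x \<in> topspace T" for x
    using that cont by (auto simp: continuous_map_def)
  have preim: "openin T {x \<in> topspace T. \<sigma> x \<in> U}" if "openin T U" for U
    using cont that by (rule openin_continuous_map_preimage)
  let ?A = "{U. openin T U \<and> (\<forall>x\<in>U. \<sigma> x \<notin> U)}"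
  have "\<Union>C \<in> ?A" if C: "subset.chain ?A C" for C
  proof -
    have "\<sigma> x \<notin> V" if "U \<in> C" "V \<in> C" "x \<in> U" for U V x
    proof -
      have "U \<in> ?A" "V \<in> ?A" "U \<subseteq> V \<or> V \<subseteq> U"
        using C that by (auto simp: subset_chain_def)
      then show ?thesis
        using that by blast
    qed
    then show ?thesis
      using C by (auto simp: subset_chain_def)
  qed
  then obtain M where M: "M \<in> ?A" and max: "\<And>X. X \<in> ?A \<Longrightarrow> M \<subseteq> X \<Longrightarrow> X = M"
    using subset_Zorn'[of ?A] by meson
  have oM: "openin T M" and dM: "\<And>x. x \<in> M \<Longrightarrow> \<sigma> x \<notin> M"
    using M by auto
  define N where "N = {x \<in> topspace T. \<sigma> x \<in> M}"
  have oN: "openin T N"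
    unfolding N_def using oM by (rule preim)
  have Mtop: "M \<subseteq> topspace T"
    using oM by (rule openin_subset)
  have "M \<inter> N = {}"
    using dM by (auto simp: N_def)
  then have disj: "T closure_of M \<inter> T closure_of N = {}"
    using assms oM oN extremally_disconnected_disjoint_closures by blast
  \<comment> \<open>Neighbourhoods of the fixed point \<open>p\<close> pull back along \<sigma> to
    neighbourhoods of \<open>p\<close>, and \<sigma> exchanges \<open>M\<close> and
    \<open>N\<close>. Hence \<open>p\<close> is adherent to both or to neither, and
    \<open>disj\<close> excludes both.\<close>
  have NM: "p \<in> T closure_of M" if pN: "p \<in> T closure_of N"
    unfolding in_closure_of
  proof (intro conjI allI impI p(1), elim conjE)
    fix W assume "p \<in> W" "openin T W"
    define Q where "Q = {x \<in> topspace T. \<sigma> x \<in> W}"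
    have "openin T Q" "p \<in> Q"
      using preim[OF \<open>openin T W\<close>] p \<open>p \<in> W\<close> by (auto simp: Q_def)
    then obtain y where "y \<in> N" "y \<in> Q"
      using pN by (meson in_closure_of)
    then show "\<exists>y. y \<in> M \<and> y \<in> W"
      by (auto simp: N_def Q_def)
  qed
  have MN: "p \<in> T closure_of N" if pM: "p \<in> T closure_of M"
    unfolding in_closure_of
  proof (intro conjI allI impI p(1), elim conjE)
    fix W assume "p \<in> W" "openin T W"
    define Q where "Q = {x \<in> topspace T. \<sigma> x \<in> W}"
    have "openin T Q" "p \<in> Q"
      using preim[OF \<open>openin T W\<close>] p \<open>p \<in> W\<close> by (auto simp: Q_def)
    then obtain y where "y \<in> M" "y \<in> Q"
      using pM by (meson in_closure_of)
    then show "\<exists>y. y \<in> N \<and> y \<in> W"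
      using Mtop \<sigma>_top[of y] invol[of y] by (auto simp: N_def Q_def)
  qed
  define V where "V = topspace T - (T closure_of M \<union> T closure_of N)"
  have oV: "openin T V"
    unfolding V_def by (intro openin_diff openin_topspace closedin_Un closedin_closure_of)
  have VM: "V \<inter> M = {}" "V \<inter> N = {}"
    using closure_of_subset[OF Mtop] closure_of_subset[OF openin_subset[OF oN]]
    by (auto simp: V_def)
  have "\<sigma> x = x" if x: "x \<in> V" for x
  proof (rule ccontr)
    assume "\<sigma> x \<noteq> x"
    moreover have xt: "x \<in> topspace T"
      using x by (simp add: V_def)
    ultimately obtain A B where AB: "openin T A" "openin T B" "x \<in> A" "\<sigma> x \<in> B" "disjnt A B"
      using assms(1) \<sigma>_top unfolding Hausdorff_space_def by metis
    \<comment> \<open>A neighbourhood of the moved point \<open>x\<close> that \<sigma> sends into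
      \<open>B\<close>, away from itself. As \<open>V\<close> avoids both \<open>M\<close> and
      \<open>N\<close>, no point of \<open>M\<close> is sent into \<open>W\<close> or conversely, so
      \<open>M \<union> W\<close> competes with the maximal \<open>M\<close>.\<close>
    define W where "W = V \<inter> A \<inter> {y \<in> topspace T. \<sigma> y \<in> B}"
    have "openin T W"
      unfolding W_def using oV AB preim by (intro openin_Int) auto
    moreover have "\<sigma> y \<notin> M \<union> W" if "y \<in> M \<union> W" for y
    proof (cases "y \<in> M")
      case True
      then have "\<sigma> y \<in> N"
        using Mtop \<sigma>_top invol by (auto simp: N_def)
      then show ?thesis
        using dM True VM by (auto simp: W_def)
    next
      case False
      then have y: "y \<in> W"
        using that by auto
      then have "\<sigma> y \<notin> M"
        using VM by (auto simp: W_def N_def)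
      moreover have "\<sigma> y \<notin> W"
        using y AB(5) by (auto simp: W_def disjnt_iff)
      ultimately show ?thesis
        by blast
    qed
    ultimately have "M \<union> W = M"
      using oM by (intro max) auto
    then have "x \<in> M"
      using x xt AB by (auto simp: W_def)
    then show False
      using x VM by blast
  qed
  moreover have "p \<in> V"
    using disj MN NM p by (auto simp: V_def)
  ultimately show thesis
    using that oV by blast
qed

section \<open>Boolean open subgroups, and ultrafilters from a maximal disjoint family\<close>

context linear_topological_group
begin

lemma exists_boolean_open_subgroup:
  assumes "Hausdorff_space T" "extremally_disconnected_space T"
  obtains E where "open_subgroup E" "\<And>x. x \<in> E \<Longrightarrow> x \<otimes> x = \<one>"
proof -
  have "continuous_map T T (\<lambda>x. inv x)"
    using topological_group by (simp add: topological_group_def)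
  then obtain V where V: "openin T V" "\<one> \<in> V" "\<And>x. x \<in> V \<Longrightarrow> inv x = x"
    using involution_fixed_points_nhd[OF assms, of "\<lambda>x. inv x" \<one>] by (auto simp: topspace_eq)
  then obtain E where E: "open_subgroup E" "E \<subseteq> V"
    by (elim obtain_open_subgroup)
  have "x \<otimes> x = \<one>" if "x \<in> E" for x
  proof -
    have "x \<in> carrier G" "inv x = x"
      using that E V openin_subset topspace_eq by blast+
    then show ?thesis
      using r_inv by metis
  qed
  then show thesis
    using that E by blast
qed

text \<open>Isbell's argument that an extremally disconnected P-space without large ultrafilters is
  discrete.\<close>

lemma Ulam_measurable_if_countable_Inter_open:
  assumes "Hausdorff_space T" "extremally_disconnected_space T"
    and nondiscrete: "T \<noteq> discrete_topology (carrier G)"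
    and P: "\<And>K :: nat \<Rightarrow> 'a set. (\<And>n. open_subgroup (K n)) \<Longrightarrow> openin T (\<Inter>n. K n)"
  shows "Ulam_measurable (card_of (carrier G))"
proof -
  let ?D = "{\<U>. pairwise disjnt \<U> \<and> (\<forall>U\<in>\<U>. openin T U \<and> U \<noteq> {} \<and> \<one> \<notin> T closure_of U)}"
  have "\<Union>C \<in> ?D" if C: "subset.chain ?D C" for C
  proof -
    have "pairwise disjnt (\<Union>C)"
      using C by (intro pairwise_chain_Union) (auto simp: subset_chain_def chain_subset_def)
    then show ?thesis
      using C by (auto simp: subset_chain_def)
  qed
  then obtain M where M: "M \<in> ?D" and max: "\<And>X. X \<in> ?D \<Longrightarrow> M \<subseteq> X \<Longrightarrow> X = M"
    using subset_Zorn'[of ?D] by meson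
  have oM: "openin T U" and neM: "U \<noteq> {}" and clM: "\<one> \<notin> T closure_of U" if "U \<in> M" for U
    using M that by auto
  have disjM: "U = V" if "U \<in> M" "V \<in> M" "x \<in> U" "x \<in> V" for U V x
    using M that by (auto simp: pairwise_def disjnt_iff)
  \<comment> \<open>Otherwise some open subgroup \<open>H\<close> misses the whole family.
    Nondiscreteness gives a nonidentity \<open>x\<close> in \<open>H\<close>, and Hausdorff
    separation gives an open set around \<open>x\<close> inside \<open>H\<close> that could be added
    to \<open>M\<close>.\<close>
  have dense: "\<one> \<in> T closure_of \<Union>M"
  proof (rule ccontr)
    assume "\<one> \<notin> T closure_of \<Union>M"
    moreover have "\<Union>M \<subseteq> carrier G"
      using oM openin_subset topspace_eq by blast
    ultimately obtain H where H: "open_subgroup H" "H \<inter> \<Union>M = {}"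
      by (auto simp: not_in_closure_iff)
    have "H \<noteq> {\<one>}"
    proof
      assume 1: "H = {\<one>}"
      have "openin T U" if "U \<subseteq> carrier G" for U
      proof -
        have "\<forall>x\<in>U. \<forall>h\<in>H. x \<otimes> h \<in> U"
          using that by (auto simp: 1)
        then show ?thesis
          unfolding openin_iff using that H by blast
      qed
      then have "T = discrete_topology (carrier G)"
        using openin_subset topspace_eq by (fastforce simp: topology_eq)
      then show False
        using nondiscrete by simp
    qed
    then obtain x where x: "x \<in> H" "x \<noteq> \<one>"
      using one_in_open_subgroup[OF H(1)] by blast
    then have "x \<in> topspace T"
      using H openin_subset unfolding open_subgroup_def by blast
    then obtain A B where AB: "openin T A" "openin T B" "x \<in> A" "\<one> \<in> B" "disjnt A B"
      using assms(1) x unfolding Hausdorff_space_def by (metis one_closed topspace_eq)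
    have "\<one> \<notin> T closure_of (A \<inter> H)"
      using AB by (auto simp: in_closure_of disjnt_iff)
    moreover have "openin T (A \<inter> H)"
      using AB H by (auto simp: open_subgroup_def)
    moreover have "pairwise disjnt (insert (A \<inter> H) M)"
      using M H(2) by (auto simp: pairwise_insert disjnt_def)
    ultimately have "insert (A \<inter> H) M = M"
      using M x AB by (intro max) auto
    then show False
      using x AB H by blast
  qed
  \<comment> \<open>Representatives index the family by points of the group, so that the ultrafilter
    lives on \<open>carrier G\<close> itself. Disjointness of the members makes \<open>e\<close>
    injective on \<open>M\<close>.\<close>
  define e where "e U = (SOME x. x \<in> U)" for U :: "'a set"
  have e: "e U \<in> U" if "U \<in> M" for U
    unfolding e_def using neM[OF that] by (simp add: some_in_eq)
  have eX: "e U \<in> carrier G" if "U \<in> M" for U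
    using e[OF that] oM[OF that] openin_subset topspace_eq by blast
  \<comment> \<open>A set \<open>A\<close> of points is declared large when the identity is adherent
    to the union \<open>u A\<close> of the members represented in \<open>A\<close>.\<close>
  define u where "u A = \<Union>{U \<in> M. e U \<in> A}" for A
  define F where "F = {A. A \<subseteq> carrier G \<and> \<one> \<in> T closure_of u A}"
  have ou: "openin T (u A)" for A
    unfolding u_def using oM by blast
  have F_mono: "B \<in> F" if "A \<in> F" "A \<subseteq> B" "B \<subseteq> carrier G" for A B
  proof -
    have "u A \<subseteq> u B"
      using that unfolding u_def by blast
    then show ?thesis
      using closure_of_mono[of "u A" "u B" T] that by (auto simp: F_def)
  qed
  \<comment> \<open>Extremal disconnectedness enters here: disjoint sets of representatives give
    disjoint open unions, whose closures cannot both contain the identity.\<close>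
  have F_disj: "A \<inter> B \<noteq> {}" if "A \<in> F" "B \<in> F" for A B
  proof
    assume "A \<inter> B = {}"
    then have "u A \<inter> u B = {}"
      using disjM unfolding u_def by blast
    then have "T closure_of u A \<inter> T closure_of u B = {}"
      using assms ou extremally_disconnected_disjoint_closures by blast
    then show False
      using that by (auto simp: F_def)
  qed
  have F_carrier: "carrier G \<in> F"
    using dense eX unfolding F_def u_def by (simp cong: conj_cong)
  have F_compl: "A \<in> F \<or> carrier G - A \<in> F" if "A \<subseteq> carrier G" for A
  proof -
    have "u A \<union> u (carrier G - A) = \<Union>M"
      using eX unfolding u_def by blast
    then have "\<one> \<in> T closure_of u A \<union> T closure_of u (carrier G - A)"
      using dense by (metis closure_of_Un)
    then show ?thesis
      using that by (auto simp: F_def)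
  qed
  \<comment> \<open>Hypothesis \<open>P\<close> enters here. Each \<open>a n\<close> is large, so an
    open subgroup \<open>K n\<close> misses the part of the family represented outside
    \<open>a n\<close>. The intersection of all \<open>K n\<close> is a neighbourhood of the
    identity missing everything represented outside \<open>\<Inter>\<A>\<close>.\<close>
  have F_sigma: "\<Inter>\<A> \<in> F" if \<A>: "\<A> \<subseteq> F" "\<A> \<noteq> {}" "countable \<A>" for \<A>
  proof (rule ccontr)
    assume "\<Inter>\<A> \<notin> F"
    moreover have "\<Inter>\<A> \<subseteq> carrier G"
      using \<A> by (auto simp: F_def)
    ultimately have cF: "carrier G - \<Inter>\<A> \<in> F"
      using F_compl by blast
    obtain a :: "nat \<Rightarrow> 'a set" where a: "\<A> = range a"
      using range_from_nat_into[OF \<A>(2,3)] by metis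
    have "\<exists>K. open_subgroup K \<and> K \<inter> u (carrier G - a n) = {}" for n
    proof -
      have "a n \<in> F"
        using \<A> a by auto
      then have "carrier G - a n \<notin> F"
        using F_disj by blast
      then have "\<one> \<notin> T closure_of u (carrier G - a n)"
        by (auto simp: F_def)
      then show ?thesis
        using not_in_closure_iff ou openin_subset topspace_eq by metis
    qed
    then obtain K where K: "\<And>n. open_subgroup (K n)" "\<And>n. K n \<inter> u (carrier G - a n) = {}"
      by metis
    have "openin T (\<Inter>n. K n)" "\<one> \<in> (\<Inter>n. K n)"
      using P K one_in_open_subgroup by auto
    moreover have "\<one> \<in> T closure_of u (carrier G - \<Inter>\<A>)"
      using cF by (simp add: F_def)
    ultimately obtain y where y: "y \<in> u (carrier G - \<Inter>\<A>)" "y \<in> (\<Inter>n. K n)"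
      by (meson in_closure_of)
    then obtain U where "U \<in> M" "y \<in> U" "e U \<in> carrier G - \<Inter>\<A>"
      by (auto simp: u_def)
    then obtain n where "y \<in> u (carrier G - a n)"
      unfolding a by (auto simp: u_def)
    then show False
      using y K by blast
  qed
  have "ultrafilter_on (carrier G) F"
  proof -
    have "A \<inter> B \<in> F" if "A \<in> F" "B \<in> F" for A B
      using F_sigma[of "{A, B}"] that by simp
    moreover have "{} \<notin> F"
      using F_disj by blast
    ultimately show ?thesis
      unfolding ultrafilter_on_def
      using F_mono F_compl F_carrier by (auto simp: F_def)
  qed
  \<comment> \<open>A singleton is never large: \<open>u {x}\<close> is empty or contained in one
    member of \<open>M\<close>, and the closure of a member misses the identity.\<close>
  moreover have "\<not> principal_on (carrier G) F"
  proof
    assume "principal_on (carrier G) F"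
    then obtain x where x: "{x} \<in> F"
      unfolding principal_on_def by auto
    show False
    proof (cases "\<exists>U\<in>M. e U = x")
      case True
      then obtain U where U: "U \<in> M" "x \<in> U"
        using e by blast
      have "u {x} \<subseteq> U"
        using U disjM e unfolding u_def by blast
      then show False
        using closure_of_mono[of "u {x}" U T] clM[OF U(1)] x by (auto simp: F_def)
    next
      case False
      then have "u {x} = {}"
        by (auto simp: u_def)
      then show False
        using x by (simp add: F_def)
    qed
  qed
  moreover have "sigma_complete F"
    using F_sigma by (simp add: sigma_complete_def)
  ultimately show ?thesis
    unfolding Ulam_measurable_def Field_card_of by blast
qed

end

section \<open>Coordinates and the colouring\<close>

lemma (in group) comm_group_if_squares_trivial:
  assumes "\<And>x. x \<in> carrier G \<Longrightarrow> x \<otimes> x = \<one>"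
  shows "comm_group G"
proof (rule group_comm_groupI)
  have inv_self: "inv x = x" if "x \<in> carrier G" for x
    using that assms inv_equality by blast
  fix x y assume "x \<in> carrier G" "y \<in> carrier G"
  then show "x \<otimes> y = y \<otimes> x"
    using inv_mult_group[of x y] by (simp add: inv_self)
qed

section \<open>Coordinates over the two-element field\<close>

text \<open>Coordinates of a Boolean group modulo a subgroup, seen as a vector space over the field
  with two elements.\<close>

lemma (in group) exists_coordinates_modulo_subgroup:
  assumes square: "\<And>x. x \<in> carrier G \<Longrightarrow> x \<otimes> x = \<one>" and H: "subgroup H G"
  obtains \<phi> :: "'a \<Rightarrow> 'a set"
  where "\<And>x. x \<in> carrier G \<Longrightarrow> finite (\<phi> x)"
    and "\<And>x y. x \<in> carrier G \<Longrightarrow> y \<in> carrier G \<Longrightarrow> \<phi> (x \<otimes> y) = sym_diff (\<phi> x) (\<phi> y)"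
    and "\<And>x. x \<in> carrier G \<Longrightarrow> \<phi> x = {} \<longleftrightarrow> x \<in> H"
proof -
  interpret comm_group G
    using square by (rule comm_group_if_squares_trivial)
  \<comment> \<open>Such an \<open>R\<close> is the graph of a homomorphism from the subgroup
    \<open>Domain R\<close> to finite sets under symmetric difference, with kernel \<open>H\<close>;
    single-valuedness follows from the clauses. Coordinates are labelled by group elements, and the
    clause \<open>S \<subseteq> Domain R\<close> keeps every element outside the domain available as
    a fresh label.\<close>
  define good where "good R \<longleftrightarrow> H \<times> {{}} \<subseteq> R \<and>
      (\<forall>x S. (x, S) \<in> R \<longrightarrow> x \<in> carrier G \<and> finite S \<and> S \<subseteq> Domain R \<and> (S = {} \<longleftrightarrow> x \<in> H)) \<and>
      (\<forall>x S y S'. (x, S) \<in> R \<longrightarrow> (y, S') \<in> R \<longrightarrow> (x \<otimes> y, sym_diff S S') \<in> R)"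
    for R :: "('a \<times> 'a set) set"
  have good_H: "(x, {}) \<in> R" if "good R" "x \<in> H" for R x
    using that unfolding good_def by auto
  have good_elem: "x \<in> carrier G" "finite S" "S \<subseteq> Domain R" "S = {} \<longleftrightarrow> x \<in> H"
    if "good R" "(x, S) \<in> R" for R x S
    using that unfolding good_def by simp_all
  have good_mult: "(x \<otimes> y, sym_diff S S') \<in> R"
    if "good R" "(x, S) \<in> R" "(y, S') \<in> R" for R x S y S'
    using that unfolding good_def by simp
  have "\<exists>M\<in>Collect good. \<forall>X\<in>Collect good. M \<subseteq> X \<longrightarrow> X = M"
  proof (rule subset_Zorn_nonempty)
    have "good (H \<times> {{}})"
      unfolding good_def using subgroup.mem_carrier[OF H] subgroup.m_closed[OF H] by auto
    then show "Collect good \<noteq> {}"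
      by blast
  next
    fix C assume "C \<noteq> {}" and C: "subset.chain (Collect good) C"
    have gC: "good R" if "R \<in> C" for R
      using C that by (auto simp: subset_chain_def)
    have dir: "\<exists>R\<in>C. p \<in> R \<and> q \<in> R" if "p \<in> \<Union>C" "q \<in> \<Union>C" for p q
      using C that unfolding subset_chain_def by blast
    have "good (\<Union>C)"
      unfolding good_def
    proof (intro conjI allI impI)
      show "H \<times> {{}} \<subseteq> \<Union>C"
        using good_H[OF gC] \<open>C \<noteq> {}\<close> by blast
    next
      fix x S y S' assume "(x, S) \<in> \<Union>C" "(y, S') \<in> \<Union>C"
      then obtain R where "R \<in> C" "(x, S) \<in> R" "(y, S') \<in> R"
        using dir by blast
      then show "(x \<otimes> y, sym_diff S S') \<in> \<Union>C"
        using good_mult[OF gC] by blast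
    next
      fix x S assume "(x, S) \<in> \<Union>C"
      then obtain R where R: "R \<in> C" "(x, S) \<in> R"
        by blast
      then show "x \<in> carrier G" "finite S" "S = {} \<longleftrightarrow> x \<in> H"
        using good_elem[OF gC] by blast+
      have "S \<subseteq> Domain R"
        using good_elem(3)[OF gC[OF R(1)] R(2)] .
      then show "S \<subseteq> Domain (\<Union>C)"
        using R(1) by blast
    qed
    then show "\<Union>C \<in> Collect good"
      by simp
  qed
  then obtain R where R: "good R" and max: "\<And>X. good X \<Longrightarrow> R \<subseteq> X \<Longrightarrow> X = R"
    by auto
  note RH = good_H[OF R] and Rx = good_elem[OF R] and Rm = good_mult[OF R]
  have R1: "(\<one>, {}) \<in> R"
    using RH subgroup.one_closed[OF H] .
  have total: "g \<in> Domain R" if g: "g \<in> carrier G" for g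
  proof (rule ccontr)
    assume gR: "g \<notin> Domain R"
    \<comment> \<open>The element \<open>g\<close> becomes a new basis vector labelled by itself.
      The kernel does not grow: if \<open>g \<otimes> x\<close> were in \<open>H\<close>, then
      multiplying by \<open>x\<close> would put \<open>g\<close> into
      \<open>Domain R\<close>.\<close>
    define R' where "R' = R \<union> {(g \<otimes> x, insert g S) | x S. (x, S) \<in> R}"
    have fresh: "g \<notin> S" if "(x, S) \<in> R" for x S
      using gR Rx[OF that] by blast
    have R'cases: "(x, S) \<in> R \<or> (\<exists>x' S'. x = g \<otimes> x' \<and> S = insert g S' \<and> (x', S') \<in> R)"
      if "(x, S) \<in> R'" for x S
      using that by (auto simp: R'_def)
    have R'I: "(g \<otimes> x, insert g S) \<in> R'" if "(x, S) \<in> R" for x S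
      using that by (auto simp: R'_def)
    have notH: "g \<otimes> x \<notin> H" if "(x, S) \<in> R" for x S
    proof
      assume "g \<otimes> x \<in> H"
      then have "(g \<otimes> x \<otimes> x, sym_diff {} S) \<in> R"
        using Rm RH that by blast
      moreover have "g \<otimes> x \<otimes> x = g"
        using g Rx(1)[OF that] square by (simp add: m_assoc)
      ultimately show False
        using gR by auto
    qed
    have "g \<in> Domain R'"
      using R'I[OF R1] g by auto
    have "good R'"
      unfolding good_def
    proof (intro conjI allI impI)
      show "H \<times> {{}} \<subseteq> R'"
        using RH by (auto simp: R'_def)
    next
      fix x S assume "(x, S) \<in> R'"
      then consider "(x, S) \<in> R" | x' S' where "x = g \<otimes> x'" "S = insert g S'" "(x', S') \<in> R"
        using R'cases by blast
      then have "x \<in> carrier G \<and> finite S \<and> S \<subseteq> Domain R' \<and> (S = {} \<longleftrightarrow> x \<in> H)"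
      proof cases
        case 1
        then show ?thesis
          using Rx[OF 1] by (auto simp: R'_def)
      next
        case 2
        then show ?thesis
          using Rx[OF 2(3)] g notH[OF 2(3)] \<open>g \<in> Domain R'\<close> by (auto simp: R'_def)
      qed
      then show "x \<in> carrier G" "finite S" "S \<subseteq> Domain R'" "S = {} \<longleftrightarrow> x \<in> H"
        by blast+
    next
      fix x S y S' assume x: "(x, S) \<in> R'" and y: "(y, S') \<in> R'"
      have mixed: "(a \<otimes> (g \<otimes> b), sym_diff A (insert g B)) \<in> R'"
        if "(a, A) \<in> R" "(b, B) \<in> R" for a A b B
      proof -
        have "a \<otimes> (g \<otimes> b) = g \<otimes> (a \<otimes> b)"
          using g Rx(1)[OF that(1)] Rx(1)[OF that(2)] by (simp add: m_lcomm)
        moreover have "sym_diff A (insert g B) = insert g (sym_diff A B)"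
          using fresh[OF that(1)] by auto
        ultimately show ?thesis
          using R'I[OF Rm[OF that]] by simp
      qed
      have both: "(g \<otimes> a \<otimes> (g \<otimes> b), sym_diff (insert g A) (insert g B)) \<in> R'"
        if "(a, A) \<in> R" "(b, B) \<in> R" for a A b B
      proof -
        have "g \<otimes> a \<otimes> (g \<otimes> b) = g \<otimes> g \<otimes> (a \<otimes> b)"
          using g Rx(1)[OF that(1)] Rx(1)[OF that(2)] by (simp add: m_ac)
        then have "g \<otimes> a \<otimes> (g \<otimes> b) = a \<otimes> b"
          using g Rx(1)[OF that(1)] Rx(1)[OF that(2)] square by simp
        moreover have "sym_diff (insert g A) (insert g B) = sym_diff A B"
          using fresh[OF that(1)] fresh[OF that(2)] by auto
        ultimately show ?thesis
          using Rm[OF that] by (simp add: R'_def)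
      qed
      from R'cases[OF x] R'cases[OF y] show "(x \<otimes> y, sym_diff S S') \<in> R'"
      proof (elim disjE exE conjE)
        assume "(x, S) \<in> R" "(y, S') \<in> R"
        then show ?thesis
          using Rm by (simp add: R'_def)
      next
        fix b B assume "(x, S) \<in> R" "y = g \<otimes> b" "S' = insert g B" "(b, B) \<in> R"
        then show ?thesis
          using mixed by simp
      next
        fix a A assume *: "x = g \<otimes> a" "S = insert g A" "(a, A) \<in> R" "(y, S') \<in> R"
        have "x \<otimes> y = y \<otimes> (g \<otimes> a)"
          using * g Rx(1) by (simp add: m_comm)
        moreover have "sym_diff S S' = sym_diff S' (insert g A)"
          using * by auto
        ultimately show ?thesis
          using mixed[OF *(4,3)] by simp
      next
        fix a A b B
        assume "x = g \<otimes> a" "S = insert g A" "(a, A) \<in> R" "y = g \<otimes> b" "S' = insert g B" "(b, B) \<in> R"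
        then show ?thesis
          using both by simp
      qed
    qed
    then have "R' = R"
      by (rule max) (simp add: R'_def)
    then show False
      using gR \<open>g \<in> Domain R'\<close> by simp
  qed
  \<comment> \<open>Multiplying the two pairs gives the identity paired with the difference of
    \<open>S\<close> and \<open>S'\<close>; the identity lies in \<open>H\<close>, so this
    difference is empty.\<close>
  have func: "S = S'" if "(x, S) \<in> R" "(x, S') \<in> R" for x S S'
  proof -
    have "(\<one>, sym_diff S S') \<in> R"
      using Rm[OF that] square[OF Rx(1)[OF that(1)]] by simp
    then have "sym_diff S S' = {}"
      using Rx(4) subgroup.one_closed[OF H] by blast
    then show ?thesis
      by blast
  qed
  define \<phi> where "\<phi> x = (SOME S. (x, S) \<in> R)" for x
  have \<phi>: "(x, \<phi> x) \<in> R" if "x \<in> carrier G" for x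
    using total[OF that] unfolding \<phi>_def by (metis Domain.cases someI)
  show thesis
  proof (rule that)
    show "\<phi> (x \<otimes> y) = sym_diff (\<phi> x) (\<phi> y)" if "x \<in> carrier G" "y \<in> carrier G" for x y
      using func[OF \<phi> Rm[OF \<phi> \<phi>]] that by simp
  qed (use Rx(2,4)[OF \<phi>] in auto)
qed

section \<open>Sunflowers and the parity of the 2-adic valuation\<close>

text \<open>Four petals of a sunflower; its root is a finite set of maximal cardinality contained in
  infinitely many members of the family.\<close>

lemma infinite_family_sym_diff_cards:
  assumes "infinite W" and W: "\<And>S. S \<in> W \<Longrightarrow> finite S \<and> card S = k"
  obtains p S1 S2 S3 S4 where "0 < p" "S1 \<in> W" "S2 \<in> W" "S3 \<in> W" "S4 \<in> W"
    "card (sym_diff S1 S2) = 2 * p"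
    "card (sym_diff (sym_diff S1 S2) (sym_diff S3 S4)) = 4 * p"
proof -
  define P where "P r \<longleftrightarrow> finite r \<and> infinite {S \<in> W. r \<subseteq> S}" for r
  have bound: "card r \<le> k" if "P r" for r
  proof -
    have "{S \<in> W. r \<subseteq> S} \<noteq> {}"
      using that unfolding P_def by (metis finite.emptyI)
    then show ?thesis
      using W card_mono by blast
  qed
  have "P {}"
    using assms by (simp add: P_def)
  then have "\<exists>r. P r \<and> (\<forall>r'. P r' \<longrightarrow> card r' \<le> card r)"
    by (rule ex_has_greatest_nat[where b = "Suc k"]) (simp add: bound le_imp_less_Suc le_SucI)
  then obtain r where r: "P r" and max: "\<And>r'. P r' \<Longrightarrow> card r' \<le> card r"
    by auto
  define W' where "W' = {S \<in> W. r \<subseteq> S}"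
  have inf: "infinite W'" and finr: "finite r"
    using r by (auto simp: P_def W'_def)
  \<comment> \<open>Maximality of the root: a point outside \<open>r\<close> lying in infinitely
    many members could be added to \<open>r\<close>. Hence a finite set off \<open>r\<close> is
    avoided by some member, and the petals can be chosen one after another.\<close>
  have fin: "finite {S \<in> W'. y \<in> S}" if "y \<notin> r" for y
  proof -
    have "\<not> P (insert y r)"
      using max[of "insert y r"] that finr by auto
    moreover have "{S \<in> W. insert y r \<subseteq> S} = {S \<in> W'. y \<in> S}"
      by (auto simp: W'_def)
    ultimately show ?thesis
      using finr by (simp add: P_def)
  qed
  have avoid: "\<exists>S\<in>W'. S \<inter> X = {}" if "finite X" "X \<inter> r = {}" for X
  proof (rule ccontr)
    assume "\<not> ?thesis"
    then have "W' \<subseteq> (\<Union>y\<in>X. {S \<in> W'. y \<in> S})"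
      by blast
    moreover have "finite (\<Union>y\<in>X. {S \<in> W'. y \<in> S})"
      using that fin by blast
    ultimately show False
      using inf finite_subset by blast
  qed
  have finW: "finite S" "card S = k" "r \<subseteq> S" "S \<in> W" if "S \<in> W'" for S
    using that W by (auto simp: W'_def)
  obtain S1 where S1: "S1 \<in> W'"
    using inf by (metis finite.emptyI ex_in_conv)
  obtain S2 where S2: "S2 \<in> W'" "S2 \<inter> (S1 - r) = {}"
    using avoid[of "S1 - r"] finW S1 by blast
  obtain S3 where S3: "S3 \<in> W'" "S3 \<inter> (S1 \<union> S2 - r) = {}"
    using avoid[of "S1 \<union> S2 - r"] finW S1 S2 by blast
  obtain S4 where S4: "S4 \<in> W'" "S4 \<inter> (S1 \<union> S2 \<union> S3 - r) = {}"
    using avoid[of "S1 \<union> S2 \<union> S3 - r"] finW S1 S2 S3 by blast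
  \<comment> \<open>The common size of the petals. It is nonzero because otherwise \<open>r\<close>
    would be the only member of the infinite family \<open>W'\<close>.\<close>
  define p where "p = k - card r"
  have cardp: "card (S - r) = p" "finite (S - r)" if "S \<in> W'" for S
    using finW[OF that] finr by (simp_all add: p_def card_Diff_subset)
  have "p \<noteq> 0"
  proof
    assume "p = 0"
    then have "W' \<subseteq> {r}"
      using cardp finW(3) by fastforce
    then show False
      using inf finite_subset by blast
  qed
  moreover have "card (sym_diff S1 S2) = 2 * p"
  proof -
    have "sym_diff S1 S2 = (S1 - r) \<union> (S2 - r)"
      using S2 finW(3)[OF S1] finW(3)[OF S2(1)] by blast
    moreover have "(S1 - r) \<inter> (S2 - r) = {}"
      using S2 by blast
    ultimately show ?thesis
      using cardp S1 S2 by (simp add: card_Un_disjoint)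
  qed
  moreover have "card (sym_diff (sym_diff S1 S2) (sym_diff S3 S4)) = 4 * p"
  proof -
    \<comment> \<open>The root belongs to all four sets and cancels, leaving the disjoint union of
      the petals.\<close>
    have "sym_diff (sym_diff S1 S2) (sym_diff S3 S4) =
        (S1 - r) \<union> ((S2 - r) \<union> ((S3 - r) \<union> (S4 - r)))" (is "?L = ?R")
    proof (rule Set.set_eqI)
      fix x
      show "x \<in> ?L \<longleftrightarrow> x \<in> ?R"
      proof (cases "x \<in> r")
        case True
        then have "x \<in> S1" "x \<in> S2" "x \<in> S3" "x \<in> S4"
          using finW(3) S1 S2(1) S3(1) S4(1) by blast+
        then show ?thesis
          using True by simp
      next
        case False
        then have "\<not> (x \<in> S1 \<and> x \<in> S2)" "\<not> (x \<in> S1 \<and> x \<in> S3)" "\<not> (x \<in> S2 \<and> x \<in> S3)"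
          "\<not> (x \<in> S1 \<and> x \<in> S4)" "\<not> (x \<in> S2 \<and> x \<in> S4)" "\<not> (x \<in> S3 \<and> x \<in> S4)"
          using S2(2) S3(2) S4(2) by blast+
        then show ?thesis
          using False by auto
      qed
    qed
    moreover have "(S1 - r) \<inter> ((S2 - r) \<union> ((S3 - r) \<union> (S4 - r))) = {}"
      "(S2 - r) \<inter> ((S3 - r) \<union> (S4 - r)) = {}" "(S3 - r) \<inter> (S4 - r) = {}"
      using S2 S3 S4 by blast+
    ultimately show ?thesis
      using cardp S1 S2 S3 S4 by (simp add: card_Un_disjoint)
  qed
  ultimately show thesis
    using that[of p S1 S2 S3 S4] finW(4) S1 S2 S3 S4 by blast
qed

text \<open>A cardinality attained infinitely often would produce members of \<open>W\<close> with
  \<open>2 * p\<close> and \<open>4 * p\<close> elements, whose 2-adic valuations differ by one and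
  so have different parity. Thus \<open>W\<close> has finitely many members of each finite
  cardinality.\<close>

lemma countable_if_sym_diff_closed_monochromatic:
  assumes "\<And>S. S \<in> W \<Longrightarrow> finite S"
    and closed: "\<And>S S'. S \<in> W \<Longrightarrow> S' \<in> W \<Longrightarrow> sym_diff S S' \<in> W"
    and mono: "\<And>S. S \<in> W \<Longrightarrow> S \<noteq> {} \<Longrightarrow> even (multiplicity 2 (card S)) \<longleftrightarrow> c"
  shows "countable W"
proof -
  have "finite {S \<in> W. card S = k}" for k
  proof (rule ccontr)
    assume "infinite {S \<in> W. card S = k}"
    then obtain p S1 S2 S3 S4 where p: "0 < p" and "S1 \<in> W" "S2 \<in> W" "S3 \<in> W" "S4 \<in> W"
      and c2: "card (sym_diff S1 S2) = 2 * p"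
      and c4: "card (sym_diff (sym_diff S1 S2) (sym_diff S3 S4)) = 4 * p"
      using assms(1) by (elim infinite_family_sym_diff_cards) auto
    then have mem: "sym_diff S1 S2 \<in> W" "sym_diff (sym_diff S1 S2) (sym_diff S3 S4) \<in> W"
      by (auto intro: closed)
    have "even (multiplicity 2 (2 * p)) \<longleftrightarrow> c"
      using mono[OF mem(1)] c2 p by (metis card.empty mult_eq_0_iff not_gr0 zero_neq_numeral)
    moreover have "even (multiplicity 2 (4 * p)) \<longleftrightarrow> c"
      using mono[OF mem(2)] c4 p by (metis card.empty mult_eq_0_iff not_gr0 zero_neq_numeral)
    moreover have "multiplicity 2 (2 * (2 * p)) = Suc (multiplicity 2 (2 * p))"
      using p by (intro multiplicity_times_same) auto
    ultimately show False
      by simp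
  qed
  then have "countable (\<Union>k. {S \<in> W. card S = k})"
    by (intro countable_UN countableI_type countable_finite)
  moreover have "(\<Union>k. {S \<in> W. card S = k}) = W"
    by auto
  ultimately show ?thesis
    by simp
qed

section \<open>Continuous characters from a decreasing sequence of open subgroups\<close>

context linear_topological_group
begin

text \<open>Elements of the two-element group are encoded as truth values, with
  \<open>\<noteq>\<close> as addition; an open kernel means a continuous character. The nonopen
  common kernel is what later makes the quotient nondiscrete.\<close>

lemma exists_characters_nonopen_kernel:
  assumes ed: "extremally_disconnected_space T"
    and square: "\<And>x. x \<in> carrier G \<Longrightarrow> x \<otimes> x = \<one>"
    and H: "\<And>n. open_subgroup (H n)" "H 0 = carrier G" "\<And>n. H (Suc n) \<subseteq> H n"
    and nonopen: "\<not> openin T (\<Inter>n. H n)"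
  obtains ch :: "nat \<Rightarrow> 'a \<Rightarrow> bool"
  where "\<And>k x y. x \<in> carrier G \<Longrightarrow> y \<in> carrier G \<Longrightarrow> ch k (x \<otimes> y) \<longleftrightarrow> ch k x \<noteq> ch k y"
    and "\<And>k. openin T {x \<in> carrier G. \<not> ch k x}"
    and "\<not> openin T {x \<in> carrier G. \<forall>k. \<not> ch k x}"
proof -
  have sub: "subgroup (H n) G" for n
    using H(1) by (simp add: open_subgroup_def)
  have "\<exists>\<psi> :: 'a \<Rightarrow> 'a set. (\<forall>x\<in>carrier G. finite (\<psi> x)) \<and>
      (\<forall>x\<in>carrier G. \<forall>y\<in>carrier G. \<psi> (x \<otimes> y) = sym_diff (\<psi> x) (\<psi> y)) \<and>
      (\<forall>x\<in>carrier G. \<psi> x = {} \<longleftrightarrow> x \<in> H (Suc n))" for n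
  proof -
    obtain \<psi> :: "'a \<Rightarrow> 'a set"
      where "\<And>x. x \<in> carrier G \<Longrightarrow> finite (\<psi> x)"
        and "\<And>x y. x \<in> carrier G \<Longrightarrow> y \<in> carrier G \<Longrightarrow>
          \<psi> (x \<otimes> y) = sym_diff (\<psi> x) (\<psi> y)"
        and "\<And>x. x \<in> carrier G \<Longrightarrow> \<psi> x = {} \<longleftrightarrow> x \<in> H (Suc n)"
      using exists_coordinates_modulo_subgroup[OF square sub[of "Suc n"]] by metis
    then show ?thesis
      by (intro exI[of _ \<psi>]) simp
  qed
  then obtain \<phi> :: "nat \<Rightarrow> 'a \<Rightarrow> 'a set"
    where \<phi>_finite: "\<And>n x. x \<in> carrier G \<Longrightarrow> finite (\<phi> n x)"
      and \<phi>_mult: "\<And>n x y. x \<in> carrier G \<Longrightarrow> y \<in> carrier G \<Longrightarrow>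
        \<phi> n (x \<otimes> y) = sym_diff (\<phi> n x) (\<phi> n y)"
      and \<phi>_ker: "\<And>n x. x \<in> carrier G \<Longrightarrow> \<phi> n x = {} \<longleftrightarrow> x \<in> H (Suc n)"
    by metis
  have mem: "x \<in> carrier G" if "x \<in> H n" for x n
    using subgroup.mem_carrier[OF sub that] .
  have \<phi>_coset: "\<phi> n (x \<otimes> h) = \<phi> n x" if "x \<in> carrier G" "h \<in> H (Suc n)" for n x h
    using \<phi>_mult[OF that(1) mem[OF that(2)]] \<phi>_ker[OF mem[OF that(2)], of n] that by simp
  have H_anti: "H n \<subseteq> H m" if "m \<le> n" for m n
    using that H(3) by (rule lift_Suc_antimono_le[rotated])
  \<comment> \<open>The layers \<open>H n - H (Suc n)\<close> are disjoint, so a point has only one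
    level \<open>n\<close> and one colour. On a coset of \<open>H (Suc n)\<close> the vector
    \<open>\<phi> n x\<close> is constant, which makes the classes open.\<close>
  define col where "col c = {x. \<exists>n. x \<in> H n \<and> x \<notin> H (Suc n) \<and>
      (even (multiplicity 2 (card (\<phi> n x))) \<longleftrightarrow> c)}" for c
  have col_open: "openin T (col c)" for c
    unfolding openin_iff
  proof (intro conjI ballI)
    show "col c \<subseteq> carrier G"
      using mem by (auto simp: col_def)
    fix x assume "x \<in> col c"
    then obtain n where n: "x \<in> H n" "x \<notin> H (Suc n)"
        "even (multiplicity 2 (card (\<phi> n x))) \<longleftrightarrow> c"
      by (auto simp: col_def)
    have "x \<otimes> h \<in> col c" if h: "h \<in> H (Suc n)" for h
    proof -
      have "x \<otimes> h \<in> H n"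
        using subgroup.m_closed[OF sub n(1)] H(3) h by blast
      moreover have "x \<otimes> h \<notin> H (Suc n)"
        using \<phi>_coset[OF mem[OF n(1)] h] \<phi>_ker[OF mem[OF n(1)]] \<phi>_ker[OF mem[OF \<open>x \<otimes> h \<in> H n\<close>]] n(2)
        by metis
      ultimately show ?thesis
        using n(3) \<phi>_coset[OF mem[OF n(1)] h] unfolding col_def by auto
    qed
    then show "\<exists>L. open_subgroup L \<and> (\<forall>h\<in>L. x \<otimes> h \<in> col c)"
      using H(1) by blast
  qed
  have "col True \<inter> col False = {}"
  proof (rule ccontr)
    assume "col True \<inter> col False \<noteq> {}"
    then obtain x m n where "x \<in> H m" "x \<notin> H (Suc m)" "x \<in> H n" "x \<notin> H (Suc n)" "m \<noteq> n"
      by (force simp: col_def)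
    then show False
      using H_anti[of "Suc m" n] H_anti[of "Suc n" m] by (meson linorder_neqE_nat Suc_leI subsetD)
  qed
  \<comment> \<open>The second use of extremal disconnectedness: the identity escapes the closure of
    one colour class, and the open subgroup \<open>L\<close> below avoids that class.\<close>
  then have "T closure_of col True \<inter> T closure_of col False = {}"
    using ed col_open extremally_disconnected_disjoint_closures by blast
  then obtain c where "\<one> \<notin> T closure_of col c"
    by blast
  moreover have "col c \<subseteq> carrier G"
    using col_open openin_subset topspace_eq by blast
  ultimately obtain L where L: "open_subgroup L" "L \<inter> col c = {}"
    by (auto simp: not_in_closure_iff)
  have subL: "subgroup L G"
    using L by (simp add: open_subgroup_def)
  \<comment> \<open>The vectors of \<open>L \<inter> H n\<close>. A nonempty one comes from a point
    off \<open>H (Suc n)\<close>, and since \<open>L\<close> misses \<open>col c\<close> its colour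
    is \<open>\<not> c\<close>; hence \<open>W n\<close> is monochromatic.\<close>
  define W where "W n = \<phi> n ` (L \<inter> H n)" for n
  have W_countable: "countable (W n)" for n
  proof (rule countable_if_sym_diff_closed_monochromatic)
    show "finite S" if "S \<in> W n" for S
      using that \<phi>_finite mem by (auto simp: W_def)
    show "sym_diff S S' \<in> W n" if S: "S \<in> W n" "S' \<in> W n" for S S'
    proof -
      obtain x y where "x \<in> L \<inter> H n" "y \<in> L \<inter> H n" "S = \<phi> n x" "S' = \<phi> n y"
        using S by (auto simp: W_def)
      moreover from this have "x \<otimes> y \<in> L \<inter> H n"
        using subgroup.m_closed[OF subL] subgroup.m_closed[OF sub] by blast
      ultimately show ?thesis
        using \<phi>_mult[of x y n] mem unfolding W_def by (metis IntD2 image_eqI)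
    qed
    show "even (multiplicity 2 (card S)) \<longleftrightarrow> \<not> c" if S: "S \<in> W n" "S \<noteq> {}" for S
    proof -
      obtain x where x: "x \<in> L" "x \<in> H n" "S = \<phi> n x"
        using S by (auto simp: W_def)
      then have "x \<notin> H (Suc n)"
        using \<phi>_ker[OF mem[OF x(2)]] S by simp
      moreover have "x \<notin> col c"
        using x L by blast
      ultimately show ?thesis
        using x unfolding col_def by auto
    qed
  qed
  define C where "C n = \<Union>(W n)" for n
  have C_countable: "countable (C n)" for n
  proof -
    have "countable S" if "S \<in> W n" for S
      using that \<phi>_finite mem by (auto simp: W_def countable_finite)
    then show ?thesis
      unfolding C_def using countable_UN[OF W_countable, of n "\<lambda>S. S"] by simp
  qed
  \<comment> \<open>The index \<open>k\<close> codes a pair \<open>(n, j)\<close>, and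
    \<open>ch k\<close> reads the \<open>j\<close>-th element of \<open>C n\<close> as a coordinate
    of \<open>\<phi> n\<close>. If \<open>C n\<close> is finite or empty, the enumeration falls back
    on a default label, which still gives a continuous character.\<close>
  define ch where "ch k x \<longleftrightarrow>
      from_nat_into (C (fst (prod_decode k))) (snd (prod_decode k)) \<in> \<phi> (fst (prod_decode k)) x"
    for k x
  show thesis
  proof (rule that)
    show "ch k (x \<otimes> y) \<longleftrightarrow> ch k x \<noteq> ch k y" if "x \<in> carrier G" "y \<in> carrier G" for k x y
      using \<phi>_mult[OF that] by (auto simp: ch_def)
    show "openin T {x \<in> carrier G. \<not> ch k x}" for k
    proof -
      let ?n = "fst (prod_decode k)"
      have "x \<otimes> h \<in> {x \<in> carrier G. \<not> ch k x}"
        if "x \<in> {x \<in> carrier G. \<not> ch k x}" "h \<in> H (Suc ?n)" for x h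
        using that \<phi>_coset[of x h ?n] mem[OF that(2)] by (auto simp: ch_def)
      then show ?thesis
        unfolding openin_iff using H(1) by blast
    qed
    show "\<not> openin T {x \<in> carrier G. \<forall>k. \<not> ch k x}"
    proof
      assume "openin T {x \<in> carrier G. \<forall>k. \<not> ch k x}"
      moreover have "\<one> \<in> {x \<in> carrier G. \<forall>k. \<not> ch k x}"
        using \<phi>_ker[OF one_closed] subgroup.one_closed[OF sub] by (auto simp: ch_def)
      ultimately obtain K where K: "open_subgroup K" "K \<subseteq> {x \<in> carrier G. \<forall>k. \<not> ch k x}"
        by (elim obtain_open_subgroup)
      \<comment> \<open>If \<open>x\<close> reaches \<open>H n\<close> but not
        \<open>H (Suc n)\<close>, then \<open>\<phi> n x\<close> has a coordinate. As
        \<open>x\<close> is in \<open>L\<close>, that coordinate belongs to \<open>C n\<close>, so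
        some \<open>ch k\<close> detects it, although \<open>K\<close> lies in the common
        kernel.\<close>
      have "x \<in> H n" if x: "x \<in> K \<inter> L" for x n
      proof (induction n)
        case 0
        then show ?case
          using x K H(2) by auto
      next
        case (Suc n)
        show ?case
        proof (rule ccontr)
          assume "x \<notin> H (Suc n)"
          then obtain y where y: "y \<in> \<phi> n x"
            using \<phi>_ker[OF mem[OF Suc]] by blast
          then have "y \<in> C n"
            using x Suc by (auto simp: C_def W_def)
          then obtain j where "from_nat_into (C n) j = y"
            using from_nat_into_surj[OF C_countable] by blast
          then have "ch (prod_encode (n, j)) x"
            using y by (simp add: ch_def)
          then show False
            using x K by blast
        qed
      qed
      then have "K \<inter> L \<subseteq> (\<Inter>n. H n)"
        by blast
      moreover have "subgroup (\<Inter>n. H n) G"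
        using sub by (intro subgroups_Inter) auto
      ultimately have "open_subgroup (\<Inter>n. H n)"
        using open_subgroup_superset open_subgroup_Int[OF K(1) L(1)] by blast
      then show False
        using nonopen by (simp add: open_subgroup_def)
    qed
  qed
qed

end

section \<open>Open images in the Cantor group\<close>

lemma extremally_disconnected_open_subspace:
  assumes "extremally_disconnected_space T" "openin T E"
  shows "extremally_disconnected_space (subtopology T E)"
  unfolding extremally_disconnected_space_def
proof (intro allI impI)
  fix U assume "openin (subtopology T E) U"
  then have "openin T (E \<inter> U)"
    using assms(2) openin_open_subtopology by (metis openin_Int)
  then have "openin T (T closure_of (E \<inter> U))"
    using assms(1) by (simp add: extremally_disconnected_space_def)
  then show "openin (subtopology T E) (subtopology T E closure_of U)"
    by (simp add: closure_of_subtopology openin_subtopology_Int2)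
qed

text \<open>For an open continuous surjection, the closure of \<open>U\<close> is the image of the
  closure of its preimage. The latter closure is open, and so is its image.\<close>

lemma extremally_disconnected_open_map_image:
  assumes ed: "extremally_disconnected_space T"
    and cont: "continuous_map T S f" and "open": "open_map T S f"
    and surj: "f ` topspace T = topspace S"
  shows "extremally_disconnected_space S"
  unfolding extremally_disconnected_space_def
proof (intro allI impI)
  fix U assume U: "openin S U"
  define P where "P = {x \<in> topspace T. f x \<in> U}"
  have oP: "openin T P"
    unfolding P_def using cont U by (rule openin_continuous_map_preimage)
  have "S closure_of U = f ` (T closure_of P)"
  proof
    have "f ` (T closure_of P) \<subseteq> S closure_of (f ` P)"
      using cont by (rule continuous_map_image_closure_subset)
    also have "\<dots> \<subseteq> S closure_of U"
      by (rule closure_of_mono) (auto simp: P_def)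
    finally show "f ` (T closure_of P) \<subseteq> S closure_of U" .
    show "S closure_of U \<subseteq> f ` (T closure_of P)"
    proof
      fix u assume u: "u \<in> S closure_of U"
      then have "u \<in> topspace S"
        using closure_of_subset_topspace by (rule subsetD[rotated])
      then obtain x where x: "x \<in> topspace T" "u = f x"
        using surj by blast
      have "x \<in> T closure_of P"
        unfolding in_closure_of
      proof (intro conjI allI impI x(1), elim conjE)
        fix V assume V: "x \<in> V" "openin T V"
        then have "openin S (f ` V)" "u \<in> f ` V"
          using "open" x by (auto simp: open_map_def)
        then obtain w where "w \<in> U" "w \<in> f ` V"
          using u by (meson in_closure_of)
        then show "\<exists>y. y \<in> P \<and> y \<in> V"
          using openin_subset[OF V(2)] by (auto simp: P_def)
      qed
      then show "u \<in> f ` (T closure_of P)"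
        using x by blast
    qed
  qed
  moreover have "openin T (T closure_of P)"
    using ed oP by (simp add: extremally_disconnected_space_def)
  ultimately show "openin S (S closure_of U)"
    using "open" by (simp add: open_map_def)
qed

lemma boolean_group_if_squares_trivial:
  assumes "group G" and square: "\<And>x. x \<in> carrier G \<Longrightarrow> x \<otimes>\<^bsub>G\<^esub> x = \<one>\<^bsub>G\<^esub>"
  shows "boolean_group G"
  unfolding boolean_group_def
proof (intro conjI ballI impI assms(1))
  interpret group G by fact
  fix x assume x: "x \<in> carrier G" "x \<noteq> \<one>\<^bsub>G\<^esub>"
  have "x [^]\<^bsub>G\<^esub> (2::nat) = \<one>\<^bsub>G\<^esub>"
    using x square by (simp add: numeral_2_eq_2)
  then have "ord x dvd 2"
    using x pow_eq_id by blast
  moreover have "ord x \<noteq> 1"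
    using x ord_eq_1 by blast
  ultimately show "ord x = 2"
    by (metis prime_nat_iff two_is_prime_nat)
qed

section \<open>Restriction to an open subgroup and the quotient topology on the image\<close>

context linear_topological_group
begin

text \<open>Intersecting with \<open>E\<close> shrinks any open subgroup of \<open>G\<close> to one
  inside \<open>E\<close>, so those inside \<open>E\<close> already describe the open subsets of
  \<open>E\<close>.\<close>

lemma linear_topological_group_open_subgroup:
  assumes "open_subgroup E" "comm_group (G\<lparr>carrier := E\<rparr>)"
  shows "linear_topological_group (G\<lparr>carrier := E\<rparr>) (subtopology T E)"
proof (rule linear_topological_groupI[where \<L> = "{L. open_subgroup L \<and> L \<subseteq> E}"])
  have subE: "subgroup E G" and oE: "openin T E"
    using assms(1) by (simp_all add: open_subgroup_def)
  show "comm_group (G\<lparr>carrier := E\<rparr>)"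
    by fact
  show "subgroup L (G\<lparr>carrier := E\<rparr>)" if "L \<in> {L. open_subgroup L \<and> L \<subseteq> E}" for L
    using that subgroup_incl[OF _ subE] by (simp add: open_subgroup_def)
  show "{L. open_subgroup L \<and> L \<subseteq> E} \<noteq> {}"
    using assms(1) by blast
  show "openin (subtopology T E) U \<longleftrightarrow> U \<subseteq> carrier (G\<lparr>carrier := E\<rparr>) \<and>
      (\<forall>x\<in>U. \<exists>L\<in>{L. open_subgroup L \<and> L \<subseteq> E}. \<forall>l\<in>L. x \<otimes>\<^bsub>G\<lparr>carrier := E\<rparr>\<^esub> l \<in> U)" for U
  proof -
    have "(\<exists>H. open_subgroup H \<and> (\<forall>h\<in>H. x \<otimes> h \<in> U)) \<longleftrightarrow>
        (\<exists>L. (open_subgroup L \<and> L \<subseteq> E) \<and> (\<forall>l\<in>L. x \<otimes> l \<in> U))" for x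
      using open_subgroup_Int[OF _ assms(1)] by (metis Int_iff Int_lower2)
    then show ?thesis
      using subgroup.subset[OF subE] by (auto simp: openin_open_subtopology[OF oE] openin_iff Bex_def)
  qed
qed

text \<open>The group \<open>B\<close> is the image of the characters, already a subgroup of
  \<open>Z2_omega\<close>, so the identity map serves as the isomorphism. Only the topology changes,
  from the quotient topology to the subspace topology.\<close>

lemma exists_continuous_isomorphism_onto_subgroup_of_Z2_omega:
  assumes ed: "extremally_disconnected_space T"
    and square: "\<And>x. x \<in> carrier G \<Longrightarrow> x \<otimes> x = \<one>"
    and ch_mult: "\<And>k x y. x \<in> carrier G \<Longrightarrow> y \<in> carrier G \<Longrightarrow> ch k (x \<otimes> y) \<longleftrightarrow> ch k x \<noteq> ch k y"
    and ch_open: "\<And>k. openin T {x \<in> carrier G. \<not> ch k x}"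
    and kernel_nonopen: "\<not> openin T {x \<in> carrier G. \<forall>k :: nat. \<not> ch k x}"
  shows "\<exists>(B :: (nat \<Rightarrow> int) monoid) (S :: (nat \<Rightarrow> int) topology).
           topological_group B S \<and> Hausdorff_space S \<and>
           S \<noteq> discrete_topology (carrier B) \<and>
           extremally_disconnected_space S \<and>
           linear_group_topology B S \<and>
           boolean_group B \<and>
           (\<exists>K h. subgroup K Z2_omega \<and>
              continuous_isomorphism B S
                (Z2_omega\<lparr>carrier := K\<rparr>) (subtopology Z2_omega_topology K) h)"
proof -
  define f where "f x = (\<lambda>k. if ch k x then 1 else 0 :: int)" for x
  define K where "K = f ` carrier G"
  define B where "B = Z2_omega\<lparr>carrier := K\<rparr>"
  have carrier_Z2: "carrier Z2_omega = {x. \<forall>k. x k \<in> {0..<2}}"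
    by (auto simp: Z2_omega_def carrier_integer_mod_group PiE_def)
  have mult_Z2: "x \<otimes>\<^bsub>Z2_omega\<^esub> y = (\<lambda>k. (x k + y k) mod 2)" for x y
    by (simp add: Z2_omega_def restrict_def)
  have one_Z2: "\<one>\<^bsub>Z2_omega\<^esub> = (\<lambda>k. 0)"
    by (simp add: Z2_omega_def restrict_def)
  have f_mult: "f (x \<otimes> y) = f x \<otimes>\<^bsub>Z2_omega\<^esub> f y" if "x \<in> carrier G" "y \<in> carrier G" for x y
    using ch_mult[OF that] by (auto simp: f_def mult_Z2)
  interpret Z2: group Z2_omega
    by (simp add: Z2_omega_def)
  interpret f: group_hom G Z2_omega f
    by unfold_locales (auto simp: hom_def f_mult, auto simp: carrier_Z2 f_def)
  have subK: "subgroup K Z2_omega"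
    unfolding K_def by (rule f.img_is_subgroup)
  interpret B: group B
    unfolding B_def using subK by (rule Z2.subgroup_imp_group)
  have B_simps: "carrier B = K" "\<And>x y. x \<otimes>\<^bsub>B\<^esub> y = x \<otimes>\<^bsub>Z2_omega\<^esub> y" "\<one>\<^bsub>B\<^esub> = \<one>\<^bsub>Z2_omega\<^esub>"
    by (simp_all add: B_def)
  have B_square: "u \<otimes>\<^bsub>B\<^esub> u = \<one>\<^bsub>B\<^esub>" if u: "u \<in> carrier B" for u
  proof -
    obtain x where "x \<in> carrier G" "u = f x"
      using u by (auto simp: B_simps K_def)
    then show ?thesis
      using f_mult[of x x] square[of x] by (simp add: B_simps)
  qed
  \<comment> \<open>The quotient topology along \<open>f\<close>. It refines the subspace topology
    because \<open>f\<close> is continuous into the product, and it inherits extremal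
    disconnectedness from \<open>T\<close> because \<open>f\<close> is open onto it.\<close>
  define S where "S = topology (\<lambda>U. U \<subseteq> K \<and> openin T {x \<in> carrier G. f x \<in> U})"
  have "istopology (\<lambda>U. U \<subseteq> K \<and> openin T {x \<in> carrier G. f x \<in> U})"
    unfolding istopology_def
  proof (intro conjI allI impI, goal_cases)
    case (2 U V)
    have "{x \<in> carrier G. f x \<in> U \<inter> V} = {x \<in> carrier G. f x \<in> U} \<inter> {x \<in> carrier G. f x \<in> V}"
      by auto
    then show ?case
      using 2 by (simp add: openin_Int)
  next
    case (4 \<U>)
    have "{x \<in> carrier G. f x \<in> \<Union>\<U>} = (\<Union>U\<in>\<U>. {x \<in> carrier G. f x \<in> U})"
      by auto
    then show ?case
      using 4 by (auto intro!: openin_Union)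
  qed auto
  then have openin_S: "openin S U \<longleftrightarrow> U \<subseteq> K \<and> openin T {x \<in> carrier G. f x \<in> U}" for U
    by (simp add: S_def)
  interpret S: linear_topological_group B S
  proof (rule linear_topological_groupI[where \<L> = "(`) f ` {H. open_subgroup H}"])
    show "comm_group B"
      using B_square by (rule B.comm_group_if_squares_trivial)
    show "subgroup L B" if L: "L \<in> (`) f ` {H. open_subgroup H}" for L
    proof -
      obtain H where H: "subgroup H G" "L = f ` H"
        using L by (auto simp: open_subgroup_def)
      then have "subgroup L Z2_omega" "L \<subseteq> K"
        using f.subgroup_img_is_subgroup subgroup.subset[OF H(1)] by (auto simp: K_def)
      then show ?thesis
        unfolding B_def using Z2.subgroup_incl subK by blast
    qed
    show "(`) f ` {H. open_subgroup H} \<noteq> {}"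
      using open_subgroup_carrier by blast
    show "openin S U \<longleftrightarrow> U \<subseteq> carrier B \<and>
        (\<forall>u\<in>U. \<exists>L\<in>(`) f ` {H. open_subgroup H}. \<forall>l\<in>L. u \<otimes>\<^bsub>B\<^esub> l \<in> U)" for U
    proof -
      define P where "P = {x \<in> carrier G. f x \<in> U}"
      \<comment> \<open>Since \<open>f\<close> is a homomorphism, cosets in \<open>G\<close>
        correspond to cosets of the images of open subgroups; this transfers
        \<open>openin_iff\<close> from \<open>T\<close> to \<open>S\<close>.\<close>
      have coset_iff: "(\<forall>h\<in>H. x \<otimes> h \<in> P) \<longleftrightarrow> (\<forall>l\<in>f ` H. f x \<otimes>\<^bsub>B\<^esub> l \<in> U)"
        if x: "x \<in> carrier G" and H: "open_subgroup H" for x H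
      proof -
        have "h \<in> carrier G" if "h \<in> H" for h
          using that H subgroup.mem_carrier by (auto simp: open_subgroup_def)
        then show ?thesis
          using x f_mult by (auto simp: P_def B_simps)
      qed
      have iff: "(\<exists>H. open_subgroup H \<and> (\<forall>h\<in>H. x \<otimes> h \<in> P)) \<longleftrightarrow>
          (\<exists>L\<in>(`) f ` {H. open_subgroup H}. \<forall>l\<in>L. f x \<otimes>\<^bsub>B\<^esub> l \<in> U)"
        if "x \<in> carrier G" for x
        unfolding bex_simps(7) using coset_iff[OF that] by auto
      have "openin T P \<longleftrightarrow> (\<forall>x\<in>P. \<exists>H. open_subgroup H \<and> (\<forall>h\<in>H. x \<otimes> h \<in> P))"
        unfolding openin_iff[of P] by (auto simp: P_def)
      also have "\<dots> \<longleftrightarrow>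
          (\<forall>x\<in>P. \<exists>L\<in>(`) f ` {H. open_subgroup H}. \<forall>l\<in>L. f x \<otimes>\<^bsub>B\<^esub> l \<in> U)"
        using iff by (intro ball_cong) (auto simp: P_def)
      finally have "openin T P \<longleftrightarrow>
          (\<forall>x\<in>P. \<exists>L\<in>(`) f ` {H. open_subgroup H}. \<forall>l\<in>L. f x \<otimes>\<^bsub>B\<^esub> l \<in> U)" .
      moreover have "U = f ` P" if "U \<subseteq> K"
        using that by (auto simp: P_def K_def)
      ultimately show ?thesis
        unfolding openin_S P_def[symmetric] B_simps(1) by auto
    qed
  qed
  have cont: "continuous_map T S f"
    unfolding continuous_map_def S.topspace_eq topspace_eq
    using openin_S by (auto simp: B_simps K_def)
  have "open_map T S f"
    unfolding open_map_def
  proof (intro allI impI)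
    fix V assume V: "openin T V"
    then have Vc: "V \<subseteq> carrier G"
      using openin_subset topspace_eq by blast
    define P where "P = {x \<in> carrier G. f x \<in> f ` V}"
    have "\<exists>H. open_subgroup H \<and> (\<forall>h\<in>H. x \<otimes> h \<in> P)" if "x \<in> P" for x
    proof -
      obtain v where v: "v \<in> V" "f x = f v" and x: "x \<in> carrier G"
        using \<open>x \<in> P\<close> by (auto simp: P_def)
      obtain H where H: "open_subgroup H" "\<And>h. h \<in> H \<Longrightarrow> v \<otimes> h \<in> V"
        using V[unfolded openin_iff] v(1) by blast
      have "x \<otimes> h \<in> P" if "h \<in> H" for h
      proof -
        have h: "h \<in> carrier G"
          using that H(1) subgroup.mem_carrier by (auto simp: open_subgroup_def)
        then have "f (x \<otimes> h) = f (v \<otimes> h)"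
          using f_mult v x Vc by auto
        then show ?thesis
          using h x H(2)[OF that] by (auto simp: P_def)
      qed
      then show ?thesis
        using H(1) by blast
    qed
    then have "openin T P"
      unfolding openin_iff[of P] by (auto simp: P_def)
    then show "openin S (f ` V)"
      using Vc by (auto simp: openin_S P_def K_def)
  qed
  with ed cont have edS: "extremally_disconnected_space S"
    by (rule extremally_disconnected_open_map_image)
      (simp add: topspace_eq S.topspace_eq B_simps K_def)
  have cont_f: "continuous_map T Z2_omega_topology f"
    unfolding Z2_omega_topology_def continuous_map_componentwise_UNIV
  proof
    fix k
    have "openin T {x \<in> carrier G. f x k \<in> V}" for V
    proof -
      \<comment> \<open>The \<open>k\<close>-th coordinate of \<open>f\<close> is constant on cosets
        of any subgroup inside the kernel of \<open>ch k\<close>, hence locally constant.\<close>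
      have "x \<otimes> h \<in> {x \<in> carrier G. f x k \<in> V}"
        if "x \<in> {x \<in> carrier G. f x k \<in> V}" "h \<in> H" "H \<subseteq> {x \<in> carrier G. \<not> ch k x}" for x h H
        using that ch_mult[of x h k] by (auto simp: f_def)
      moreover obtain H where "open_subgroup H" "H \<subseteq> {x \<in> carrier G. \<not> ch k x}"
        using obtain_open_subgroup[OF ch_open[of k]] ch_mult[of \<one> \<one> k] by auto
      ultimately show ?thesis
        unfolding openin_iff by blast
    qed
    then show "continuous_map T (discrete_topology (carrier (integer_mod_group 2))) (\<lambda>x. f x k)"
      by (auto simp: continuous_map_def topspace_eq carrier_integer_mod_group f_def)
  qed
  have cont_id: "continuous_map S Z2_omega_topology (\<lambda>x. x)"
  proof -
    have "K \<subseteq> topspace Z2_omega_topology"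
      using continuous_map_image_subset_topspace[OF cont_f] by (simp add: K_def topspace_eq)
    moreover have "openin S {u \<in> K. u \<in> V}" if "openin Z2_omega_topology V" for V
    proof -
      have "{x \<in> carrier G. f x \<in> {u \<in> K. u \<in> V}} = {x \<in> topspace T. f x \<in> V}"
        by (auto simp: K_def topspace_eq)
      then show ?thesis
        using openin_continuous_map_preimage[OF cont_f that] unfolding openin_S by auto
    qed
    ultimately show ?thesis
      by (auto simp: continuous_map_def S.topspace_eq B_simps(1))
  qed
  have "Hausdorff_space Z2_omega_topology"
    by (simp add: Z2_omega_topology_def Hausdorff_space_product_topology)
  then have "Hausdorff_space S"
    using cont_id by (rule Hausdorff_space_injective_preimage) simp
  \<comment> \<open>The preimage of the identity under \<open>f\<close> is the common kernel of the
    characters, which is not open.\<close>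
  moreover have "S \<noteq> discrete_topology (carrier B)"
  proof
    assume "S = discrete_topology (carrier B)"
    then have "openin S {\<one>\<^bsub>B\<^esub>}"
      using B.one_closed by simp
    moreover have "f x = \<one>\<^bsub>Z2_omega\<^esub> \<longleftrightarrow> (\<forall>k. \<not> ch k x)" for x
      by (auto simp: f_def one_Z2 fun_eq_iff)
    ultimately show False
      using kernel_nonopen by (simp add: openin_S B_simps)
  qed
  moreover have "boolean_group B"
    using B.is_group B_square by (rule boolean_group_if_squares_trivial)
  moreover have "continuous_isomorphism B S
      (Z2_omega\<lparr>carrier := K\<rparr>) (subtopology Z2_omega_topology K) (\<lambda>x. x)"
    unfolding continuous_isomorphism_def B_def[symmetric]
    using cont_id
    by (auto simp: continuous_map_in_subtopology S.topspace_eq B_simps(1) iso_def hom_def bij_betw_def)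
  ultimately show ?thesis
    using S.topological_group S.linear edS subK by blast
qed

end

section \<open>Passage to the Boolean subgroup and assembly\<close>

theorem mainTheorem2:
  assumes "\<exists>(G :: 'a monoid) (T :: 'a topology).
             topological_group G T \<and> Hausdorff_space T \<and>
             T \<noteq> discrete_topology (carrier G) \<and>
             extremally_disconnected_space T \<and>
             linear_group_topology G T \<and>
             \<not> Ulam_measurable (card_of (carrier G))"
  shows "\<exists>(B :: (nat \<Rightarrow> int) monoid) (S :: (nat \<Rightarrow> int) topology).
           topological_group B S \<and> Hausdorff_space S \<and>
           S \<noteq> discrete_topology (carrier B) \<and>
           extremally_disconnected_space S \<and>
           linear_group_topology B S \<and>
           boolean_group B \<and>
           (\<exists>K h. subgroup K Z2_omega \<and>
              continuous_isomorphism B S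
                (Z2_omega\<lparr>carrier := K\<rparr>) (subtopology Z2_omega_topology K) h)"
proof -
  obtain G :: "'a monoid" and T :: "'a topology" where
    G: "topological_group G T" "linear_group_topology G T" and
    T: "Hausdorff_space T" "T \<noteq> discrete_topology (carrier G)" "extremally_disconnected_space T" and
    nonmeas: "\<not> Ulam_measurable (card_of (carrier G))"
    using assms by blast
  interpret linear_topological_group G T
    using G by (simp add: linear_topological_group_def linear_topological_group_axioms_def
        topological_group_def)
  obtain E where E: "open_subgroup E" and square: "\<And>x. x \<in> E \<Longrightarrow> x \<otimes>\<^bsub>G\<^esub> x = \<one>\<^bsub>G\<^esub>"
    using exists_boolean_open_subgroup T by blast
  obtain K :: "nat \<Rightarrow> 'a set" where K: "\<And>n. open_subgroup (K n)" "\<not> openin T (\<Inter>n. K n)"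
    using Ulam_measurable_if_countable_Inter_open T nonmeas by blast
  \<comment> \<open>Partial intersections make the sequence decreasing. The strict bound
    \<open>i<n\<close> leaves no factor at \<open>n = 0\<close>, so \<open>H 0\<close> is
    \<open>E\<close>, the whole group after restriction.\<close>
  define H where "H n = E \<inter> (\<Inter>i<n. K i)" for n
  have H_Suc: "H (Suc n) = H n \<inter> K n" for n
    by (auto simp: H_def lessThan_Suc)
  have H_open: "open_subgroup (H n)" for n
  proof (induction n)
    case 0
    then show ?case
      using E by (simp add: H_def)
  next
    case (Suc n)
    then show ?case
      unfolding H_Suc using K(1) by (rule open_subgroup_Int)
  qed
  have H_E: "H n \<subseteq> E" for n
    by (auto simp: H_def)
  have subE: "subgroup E G" and oE: "openin T E"
    using E by (simp_all add: open_subgroup_def)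
  \<comment> \<open>A subgroup containing an open subgroup is open, so openness of the smaller
    intersection would carry over to that of the \<open>K n\<close>.\<close>
  have "(\<Inter>n. H n) \<subseteq> (\<Inter>n. K n)"
    using H_Suc by blast
  moreover have "subgroup (\<Inter>n. K n) G"
    using K(1) by (intro subgroups_Inter) (auto simp: open_subgroup_def)
  moreover have "subgroup (\<Inter>n. H n) G"
    using H_open by (intro subgroups_Inter) (auto simp: open_subgroup_def)
  ultimately have H_nonopen: "\<not> openin T (\<Inter>n. H n)"
    using open_subgroup_superset[of "\<Inter>n. H n" "\<Inter>n. K n"] K(2) unfolding open_subgroup_def by blast
  let ?E = "G\<lparr>carrier := E\<rparr>" and ?T = "subtopology T E"
  have squareE: "x \<otimes>\<^bsub>?E\<^esub> x = \<one>\<^bsub>?E\<^esub>" if "x \<in> carrier ?E" for x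
    using that square by simp
  have "comm_group ?E"
    using squareE by (rule group.comm_group_if_squares_trivial[OF subgroup_imp_group[OF subE]])
  then interpret E: linear_topological_group ?E ?T
    using E by (rule linear_topological_group_open_subgroup[rotated])
  have edE: "extremally_disconnected_space ?T"
    using T(3) oE by (rule extremally_disconnected_open_subspace)
  have openE: "openin ?T U \<longleftrightarrow> openin T U" if "U \<subseteq> E" for U
    using that by (simp add: openin_open_subtopology[OF oE])
  have H_openE: "E.open_subgroup (H n)" for n
    unfolding E.open_subgroup_def openE[OF H_E]
    using H_open[of n] subgroup_incl[OF _ subE H_E] by (simp add: open_subgroup_def)
  have H_0: "H 0 = carrier ?E"
    by (simp add: H_def)
  have H_decreasing: "H (Suc n) \<subseteq> H n" for n
    by (simp add: H_Suc)
  have H_nonopenE: "\<not> openin ?T (\<Inter>n. H n)"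
    using H_nonopen openE[of "\<Inter>n. H n"] H_E by blast
  show ?thesis
    by (rule E.exists_characters_nonopen_kernel
        [OF edE squareE H_openE H_0 H_decreasing H_nonopenE], assumption)
      (rule E.exists_continuous_isomorphism_onto_subgroup_of_Z2_omega[OF edE squareE])
qed

end
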